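(* Let $0<\alpha\le 1$ and $k>0$. The identity $$E_\alpha\left(-2k^\alpha t^\alpha\right)=E_\alpha\left(-k^\alpha t^\alpha\right)E_\alpha\left(-k^\alpha t^\alpha\right)\qquad\text{for all } t\ge 0$$ holds if and only if $\alpha=1$.
   Context: The Mittag-Leffler function is $E_\alpha(z)=\sum_{j=0}^\infty \dfrac{z^j}{\Gamma(\alpha j+1)}$ for $\alpha>0$. *)

theory Defs
  imports "HOL-Analysis.Analysis"
begin

(* Only used for \<alpha> > 0, where the series converges absolutely for every z, so that the
   default value of suminf for divergent series plays no role. The definition covers both
   real and complex z. *)
definition mittag_leffler :: "real \<Rightarrow> 'a \<Rightarrow> 'a::{real_normed_field, banach}" where
  "mittag_leffler \<alpha> z = (\<Sum>j. z ^ j / of_real (Gamma (\<alpha> * real j + 1)))"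

end

theory Submission
  imports Defs "HOL-Complex_Analysis.Cauchy_Integral_Formula"
begin

text \<open>
  For \<open>\<alpha> = 1\<close> the Mittag-Leffler function is the exponential function, and the identity is its
  addition theorem.

  For the converse, as \<open>t\<close> runs through \<open>[0, \<infinity>)\<close> the argument \<open>z = - k\<^sup>\<alpha> t\<^sup>\<alpha>\<close> runs through
  \<open>(-\<infinity>, 0]\<close>, so the identity says that the power series of \<open>E\<^sub>\<alpha>(2z)\<close> and of \<open>E\<^sub>\<alpha>(z)\<^sup>2\<close>
  agree on a set accumulating at \<open>0\<close>. Hence all their coefficients agree. The coefficients of
  \<open>1\<close> and \<open>z\<close> agree for every \<open>\<alpha>\<close>; the first informative one is that of \<open>z\<^sup>2\<close>, which gives
  \<open>\<Gamma>(2\<alpha> + 1) = 2 \<Gamma>(\<alpha> + 1)\<^sup>2\<close>. The logarithm of \<open>\<Gamma>(2\<alpha> + 1) / \<Gamma>(\<alpha> + 1)\<^sup>2\<close> has derivative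
  \<open>2 (\<psi>(2\<alpha> + 1) - \<psi>(\<alpha> + 1))\<close>, which is positive because the digamma function \<open>\<psi>\<close> is
  increasing. The quotient is therefore strictly increasing in \<open>\<alpha>\<close> and takes the value \<open>2\<close> only
  at \<open>\<alpha> = 1\<close>.
\<close>

text \<open>
  Convergence in the unit disc is enough to compare coefficients at \<open>0\<close>, and there it follows from
  the geometric series: \<open>\<Gamma>\<close> is increasing from \<open>\<Gamma>(2) = 1\<close> on, so all but finitely many of the
  coefficients are at most \<open>1\<close>.
\<close>

lemma summable_norm_mittag_leffler:
  fixes z :: "'a::{real_normed_field, banach}"
  assumes "0 < \<alpha>" and "norm z < 1"
  shows "summable (\<lambda>j. norm (z ^ j / of_real (Gamma (\<alpha> * real j + 1))))"
proof (rule summable_norm_comparison_test)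
  show "summable (\<lambda>j. norm z ^ j)"
    using assms(2) by simp
  obtain N :: nat where N: "1 / \<alpha> < real N"
    using reals_Archimedean2 by blast
  show "\<exists>N. \<forall>j\<ge>N. norm (z ^ j / of_real (Gamma (\<alpha> * real j + 1))) \<le> norm z ^ j"
  proof (intro exI[of _ N] allI impI)
    fix j assume "N \<le> j"
    then have "1 / \<alpha> < real j"
      using N by linarith
    then have "2 < \<alpha> * real j + 1"
      using assms(1) by (simp add: field_simps)
    then have "Gamma (2::real) < Gamma (\<alpha> * real j + 1)"
      by (intro Gamma_real_strict_mono) auto
    then have "1 \<le> Gamma (\<alpha> * real j + 1)"
      using Gamma_fact[of 1, where 'a = real] by simp
    then show "norm (z ^ j / of_real (Gamma (\<alpha> * real j + 1))) \<le> norm z ^ j"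
      by (simp add: norm_divide norm_power divide_le_eq mult_le_cancel_left1)
  qed
qed

lemma mittag_leffler_one: "mittag_leffler 1 z = exp z"
  for z :: "'a::{real_normed_field, banach}"
proof -
  have "Gamma (real j + 1) = fact j" for j
    using Gamma_fact[of j, where 'a = real] by (simp add: add.commute)
  then show ?thesis
    by (simp add: mittag_leffler_def exp_def scaleR_conv_of_real field_simps)
qed

text \<open>
  The one-sided form of uniqueness for power series: zeros at all small negative reals accumulate
  at \<open>0\<close>, whereas the zeros of a nonzero power series are isolated.
\<close>

lemma powser_zero_on_left_imp_coeffs_zero:
  fixes a :: "nat \<Rightarrow> real"
  assumes "0 < r"
    and summable: "\<And>x. \<bar>x\<bar> < r \<Longrightarrow> summable (\<lambda>n. a n * x ^ n)"
    and zero: "\<And>x. - r < x \<Longrightarrow> x \<le> 0 \<Longrightarrow> (\<Sum>n. a n * x ^ n) = 0"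
  shows "a m = 0"
proof (rule ccontr)
  assume "a m \<noteq> 0"
  have "a 0 = 0"
    using zero[of 0] \<open>0 < r\<close> by simp
  with \<open>a m \<noteq> 0\<close> have "0 < m"
    by (cases m) auto
  obtain s where "0 < s" and
    s: "\<And>z. z \<in> cball 0 s - {0} \<Longrightarrow> (\<Sum>n. a n * z ^ n) \<noteq> 0"
    using powser_0_nonzero[of r 0 a "\<lambda>x. \<Sum>n. a n * x ^ n" m]
      \<open>0 < r\<close> \<open>a 0 = 0\<close> \<open>a m \<noteq> 0\<close> \<open>0 < m\<close> summable
    by (auto simp: summable_sums)
  define x where "x = - min s (r / 2)"
  have "x \<in> cball 0 s - {0}" "- r < x" "x \<le> 0"
    using \<open>0 < s\<close> \<open>0 < r\<close> by (auto simp: x_def)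
  then show False
    using s zero by blast
qed

text \<open>
  By the Cauchy product, \<open>E\<^sub>\<alpha>(2z) - E\<^sub>\<alpha>(z)\<^sup>2\<close> is a power series for \<open>\<bar>z\<bar> < 1/2\<close>. Its coefficient
  of \<open>z\<^sup>2\<close> is \<open>4 c\<^sub>2 - (2 c\<^sub>2 + c\<^sub>1\<^sup>2)\<close>, where \<open>c\<^sub>j = 1 / \<Gamma>(\<alpha> j + 1)\<close>.
\<close>

lemma Gamma_eq_if_mittag_leffler_double:
  fixes \<alpha> :: real
  assumes "0 < \<alpha>"
    and double: "\<And>z::real. z \<le> 0 \<Longrightarrow> mittag_leffler \<alpha> (2 * z) = (mittag_leffler \<alpha> z)\<^sup>2"
  shows "Gamma (2 * \<alpha> + 1) = 2 * (Gamma (\<alpha> + 1))\<^sup>2"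
proof -
  define c where "c j = 1 / Gamma (\<alpha> * real j + 1)" for j
  define d where "d n = 2 ^ n * c n - (\<Sum>i\<le>n. c i * c (n - i))" for n
  have ml: "mittag_leffler \<alpha> z = (\<Sum>j. c j * z ^ j)" for z :: real
    by (simp add: mittag_leffler_def c_def)
  have abs_summable: "summable (\<lambda>j. norm (c j * z ^ j))" if "\<bar>z\<bar> < 1" for z :: real
    using summable_norm_mittag_leffler[OF assms(1), of z] that by (simp add: c_def)
  have d_sums: "(\<lambda>n. d n * z ^ n) sums (mittag_leffler \<alpha> (2 * z) - (mittag_leffler \<alpha> z)\<^sup>2)"
    if "\<bar>z\<bar> < 1 / 2" for z :: real
  proof -
    have "(\<lambda>n. c n * (2 * z) ^ n) sums mittag_leffler \<alpha> (2 * z)"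
      unfolding ml using that by (intro summable_sums summable_norm_cancel[OF abs_summable]) auto
    moreover have "(\<lambda>n. \<Sum>i\<le>n. c i * z ^ i * (c (n - i) * z ^ (n - i)))
        sums (mittag_leffler \<alpha> z)\<^sup>2"
      unfolding ml power2_eq_square using that
      by (intro Cauchy_product_sums abs_summable) auto
    moreover have "(\<Sum>i\<le>n. c i * z ^ i * (c (n - i) * z ^ (n - i)))
        = (\<Sum>i\<le>n. c i * c (n - i)) * z ^ n" for n
      unfolding sum_distrib_right
    proof (rule sum.cong)
      fix i assume "i \<in> {..n}"
      then have "z ^ n = z ^ i * z ^ (n - i)"
        by (simp flip: power_add)
      then show "c i * z ^ i * (c (n - i) * z ^ (n - i)) = c i * c (n - i) * z ^ n"
        by simp
    qed simp
    ultimately show ?thesis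
      using sums_diff by (fastforce simp: d_def algebra_simps power_mult_distrib)
  qed
  have "d 2 = 0"
  proof (rule powser_zero_on_left_imp_coeffs_zero)
    show "summable (\<lambda>n. d n * z ^ n)" if "\<bar>z\<bar> < 1 / 2" for z
      using d_sums[OF that] by (rule sums_summable)
    show "(\<Sum>n. d n * z ^ n) = 0" if "- (1 / 2) < z" "z \<le> 0" for z
      using sums_unique[OF d_sums[of z]] double[of z] that by simp
  qed auto
  then have "2 * c 2 = (c 1)\<^sup>2"
    by (simp add: d_def c_def numeral_2_eq_2 power2_eq_square)
  moreover have "0 < Gamma (2 * \<alpha> + 1)" "0 < Gamma (\<alpha> + 1)"
    using assms(1) by (auto intro!: Gamma_real_pos)
  ultimately show ?thesis
    by (simp add: c_def field_simps)
qed

text \<open>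
  On the logarithmic scale this is the monotonicity of the digamma function, since
  \<open>u + 1 < 2u + 1\<close> for \<open>u > 0\<close>.
\<close>

lemma Gamma_double_quotient_strict_mono:
  fixes x y :: real
  assumes "0 < x" and "x < y"
  shows "Gamma (2 * x + 1) / (Gamma (x + 1))\<^sup>2 < Gamma (2 * y + 1) / (Gamma (y + 1))\<^sup>2"
proof -
  define L where "L u = ln_Gamma (2 * u + 1) - 2 * ln_Gamma (u + 1)" for u :: real
  have "L x < L y"
    unfolding L_def
  proof (rule DERIV_pos_imp_increasing[OF assms(2)])
    fix u assume "x \<le> u"
    then have "0 < u"
      using assms(1) by simp
    then show "\<exists>D. ((\<lambda>u. ln_Gamma (2 * u + 1) - 2 * ln_Gamma (u + 1))
        has_real_derivative D) (at u) \<and> 0 < D"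
      by (intro exI[of _ "2 * (Digamma (2 * u + 1) - Digamma (u + 1))"] conjI)
        (auto intro!: derivative_eq_intros Digamma_real_strict_mono)
  qed
  moreover have "exp (L u) = Gamma (2 * u + 1) / (Gamma (u + 1))\<^sup>2" if "0 < u" for u
    using that by (simp add: L_def exp_diff Gamma_real_pos_exp exp_double)
  ultimately show ?thesis
    using assms by (metis exp_less_mono less_trans)
qed

theorem proposition2:
  fixes \<alpha> k :: real
  assumes "0 < \<alpha>" and "\<alpha> \<le> 1" and "k > 0"
  shows "(\<forall>t::real. t \<ge> 0 \<longrightarrow>
            mittag_leffler \<alpha> (- 2 * k powr \<alpha> * t powr \<alpha>)
              = mittag_leffler \<alpha> (- (k powr \<alpha> * t powr \<alpha>)) * mittag_leffler \<alpha> (- (k powr \<alpha> * t powr \<alpha>)))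
         \<longleftrightarrow> \<alpha> = 1"
    (is "?identity \<longleftrightarrow> _")
proof
  assume identity: ?identity
  have "mittag_leffler \<alpha> (2 * z) = (mittag_leffler \<alpha> z)\<^sup>2" if "z \<le> 0" for z :: real
  proof -
    define t where "t = (- z) powr (1 / \<alpha>) / k"
    have "k powr \<alpha> * t powr \<alpha> = (k * t) powr \<alpha>"
      by (rule powr_mult[symmetric])
    also have "\<dots> = - z"
      using assms that by (simp add: t_def powr_powr)
    finally have "k powr \<alpha> * t powr \<alpha> = - z" .
    moreover have "0 \<le> t"
      using assms(3) by (simp add: t_def)
    ultimately show ?thesis
      using identity[rule_format, of t] by (simp add: power2_eq_square mult.assoc)
  qed
  then have "Gamma (2 * \<alpha> + 1) = 2 * (Gamma (\<alpha> + 1))\<^sup>2"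
    by (rule Gamma_eq_if_mittag_leffler_double[OF assms(1)])
  moreover have "0 < Gamma (\<alpha> + 1)"
    using assms(1) by (intro Gamma_real_pos) simp
  ultimately have quotient: "Gamma (2 * \<alpha> + 1) / (Gamma (\<alpha> + 1))\<^sup>2 = 2"
    by simp
  have "Gamma 2 = (1::real)" "Gamma 3 = (2::real)"
    using Gamma_fact[of 1, where 'a = real] Gamma_fact[of 2, where 'a = real] by simp_all
  then have "\<not> \<alpha> < 1"
    using Gamma_double_quotient_strict_mono[of \<alpha> 1] assms(1) quotient by auto
  then show "\<alpha> = 1"
    using assms(2) by simp
next
  assume "\<alpha> = 1"
  then show ?identity
    by (simp add: mittag_leffler_one flip: exp_add)
qed

end
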